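(* Let $\preceq$ be a computable partial order on $\mathbb N$. Then there exist a set $A\le_T\emptyset'$ and sets $B_0,B_1,\dots\subseteq\mathbb N$ such that $$B_i\equiv_{\rm bfo}A\qquad\text{for every }i\in\mathbb N,$$ and, for all $i,j\in\mathbb N$, $$B_i\le_1 B_j\quad\text{if and only if}\quad i\preceq j.$$ Hence the function $i\mapsto\deg_1(B_i)$ is an order-embedding of $(\mathbb N,\preceq)$ into the partially ordered set of $1$-degrees contained in the bounded finite-one degree of $A$.
   Context: All sets are subsets of $\mathbb N=\{0,1,\dots\}$; $\emptyset'$ is the Turing jump of the empty set. A partial order $\preceq$ (reflexive, antisymmetric, transitive) on $\mathbb N$ is computable if $\{(i,j):i\preceq j\}$ is a computable set. For $A,B\subseteq\mathbb N$: $A\le_1 B$ means there is a total computable injective $f:\mathbb N\to\mathbb N$ with $x\in A\iff f(x)\in B$ for all $x$. $A\le_{\rm bfo}B$ means there are a total computable $f:\mathbb N\to\mathbb N$ and a constant $c\ge1$ with $x\in A\iff f(x)\in B$ for all $x$ and $|f^{-1}(y)|\le c$ for all $y$. For $r\in\{1,{\rm bfo}\}$, $A\equiv_r B$ means $A\le_r B$ and $B\le_r A$. The equivalence classes of $\equiv_1$ are the $1$-degrees ($\deg_1(X)$ is that of $X$), those of $\equiv_{\rm bfo}$ the bounded finite-one degrees. Since $\le_1$ implies $\le_{\rm bfo}$, each bounded finite-one degree is a union of $1$-degrees; these are partially ordered by $\deg_1(X)\le\deg_1(Y)\iff X\le_1 Y$. An order-embedding is a map preserving and reflecting the order. *)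

theory Defs
  imports "HOL-Library.Nat_Bijection"
begin

text \<open>
  Programs for the unary partial functions that are partial recursive relative to a set.
  Arguments of several-place functions are packed by the Cantor pairing \<^const>\<open>prod_encode\<close>.
\<close>

datatype program =
    PZero
  | PSucc
  | PFst
  | PSnd
  | PQuery
  | PPair program program
  | PComp program program
  | PRec program program
  | PMin program

text \<open>
  \<open>run X p x\<close> is the result of \<open>p\<close> on input \<open>x\<close> relative to \<open>X\<close>; \<open>None\<close> stands for divergence.
  \<open>PRec\<close> is primitive recursion:  \<open>h(a,0) = p(a)\<close>,  \<open>h(a,n+1) = q(a,(n,h(a,n)))\<close>.
  \<open>PMin\<close> is unbounded search: the result is an \<open>n\<close> with \<open>p(x,n) = 0\<close>, and it is required that
  \<open>p(x,m)\<close> is defined and nonzero for every \<open>m < n\<close>, so there is at most one such \<open>n\<close>.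
\<close>

primrec run :: "nat set \<Rightarrow> program \<Rightarrow> nat \<Rightarrow> nat option" where
  "run X PZero x = Some 0"
| "run X PSucc x = Some (Suc x)"
| "run X PFst x = Some (fst (prod_decode x))"
| "run X PSnd x = Some (snd (prod_decode x))"
| "run X PQuery x = Some (of_bool (x \<in> X))"
| "run X (PPair p q) x =
     Option.bind (run X p x) (\<lambda>u. Option.bind (run X q x) (\<lambda>v. Some (prod_encode (u, v))))"
| "run X (PComp p q) x = Option.bind (run X q x) (run X p)"
| "run X (PRec p q) x =
     (case prod_decode x of (a, n) \<Rightarrow>
        rec_nat (run X p a)
          (\<lambda>m r. Option.bind r (\<lambda>v. run X q (prod_encode (a, prod_encode (m, v))))) n)"
| "run X (PMin p) x =
     (let stops = (\<lambda>n. run X p (prod_encode (x, n)) = Some 0 \<and>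
                       (\<forall>m<n. \<exists>k. run X p (prod_encode (x, m)) = Some (Suc k)))
      in if \<exists>n. stops n then Some (THE n. stops n) else None)"

primrec index_of :: "program \<Rightarrow> nat" where
  "index_of PZero = 0"
| "index_of PSucc = 1"
| "index_of PFst = 2"
| "index_of PSnd = 3"
| "index_of PQuery = 4"
| "index_of (PPair p q) = 5 + 4 * prod_encode (index_of p, index_of q)"
| "index_of (PComp p q) = 6 + 4 * prod_encode (index_of p, index_of q)"
| "index_of (PRec p q) = 7 + 4 * prod_encode (index_of p, index_of q)"
| "index_of (PMin p) = 8 + 4 * index_of p"

lemma inj_index_of: "inj index_of"
proof (rule injI)
  have tags: "5 + 4*a \<noteq> 6 + 4*b" "5 + 4*a \<noteq> 7 + 4*b" "5 + 4*a \<noteq> 8 + 4*b"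
    "6 + 4*a \<noteq> 7 + 4*b" "6 + 4*a \<noteq> 8 + 4*b" "7 + 4*a \<noteq> 8 + 4*b" for a b :: nat
    by presburger+
  fix p q show "index_of p = index_of q \<Longrightarrow> p = q"
  proof (induction p arbitrary: q)
    case (PPair p1 p2) then show ?case
      by (cases q) (use tags in \<open>simp_all only: index_of.simps, simp_all\<close>)
  next
    case (PComp p1 p2) then show ?case
      by (cases q) (use tags tags[symmetric] in \<open>simp_all only: index_of.simps, simp_all\<close>)
  next
    case (PRec p1 p2) then show ?case
      by (cases q) (use tags tags[symmetric] in \<open>simp_all only: index_of.simps, simp_all\<close>)
  next
    case (PMin p) then show ?case
      by (cases q) (use tags[symmetric] in \<open>simp_all only: index_of.simps, simp_all\<close>)
  qed (case_tac q; simp)+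
qed

lemma surj_index_of: "surj index_of"
proof -
  have "\<exists>p. index_of p = n" for n
  proof (induction n rule: less_induct)
    case (less n)
    show ?case
    proof (cases "n < 5")
      case True
      then have "n = 0 \<or> n = 1 \<or> n = 2 \<or> n = 3 \<or> n = 4" by auto
      then show ?thesis
        by (elim disjE) (metis index_of.simps)+
    next
      case False
      define k where "k = (n - 5) div 4"
      obtain a b where ab: "k = prod_encode (a, b)"
        by (metis prod_decode_inverse surj_pair)
      have k: "k < n" and n: "n = 5 + 4*k \<or> n = 6 + 4*k \<or> n = 7 + 4*k \<or> n = 8 + 4*k"
        using False unfolding k_def by presburger+
      have "a < n" "b < n"
        using k ab le_prod_encode_1[of a b] le_prod_encode_2[of b a] by auto
      then obtain p q r where "index_of p = a" "index_of q = b" "index_of r = k"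
        using less k by metis
      then have "index_of (PPair p q) = 5 + 4*k" "index_of (PComp p q) = 6 + 4*k"
        "index_of (PRec p q) = 7 + 4*k" "index_of (PMin r) = 8 + 4*k"
        using ab by simp_all
      then show ?thesis using n by metis
    qed
  qed
  then show ?thesis by (metis surjI)
qed

definition computable_in :: "nat set \<Rightarrow> (nat \<Rightarrow> nat) \<Rightarrow> bool" where
  "computable_in X f \<longleftrightarrow> (\<exists>p. \<forall>x. run X p x = Some (f x))"

abbreviation computable :: "(nat \<Rightarrow> nat) \<Rightarrow> bool" where
  "computable \<equiv> computable_in {}"

definition turing_le :: "nat set \<Rightarrow> nat set \<Rightarrow> bool" (infix \<open>\<le>\<^sub>T\<close> 50) where
  "A \<le>\<^sub>T X \<longleftrightarrow> computable_in X (\<lambda>x. of_bool (x \<in> A))"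

definition computable_set :: "nat set \<Rightarrow> bool" where
  "computable_set A \<longleftrightarrow> computable (\<lambda>x. of_bool (x \<in> A))"

text \<open>The jump is the set of all \<open>e\<close> such that the \<open>e\<close>-th program relative to \<open>X\<close> halts on \<open>e\<close>.\<close>

definition turing_jump :: "nat set \<Rightarrow> nat set" where
  "turing_jump X = {index_of p |p. run X p (index_of p) \<noteq> None}"

definition one_le :: "nat set \<Rightarrow> nat set \<Rightarrow> bool" (infix \<open>\<le>\<^sub>1\<close> 50) where
  "A \<le>\<^sub>1 B \<longleftrightarrow> (\<exists>f. computable f \<and> inj f \<and> (\<forall>x. x \<in> A \<longleftrightarrow> f x \<in> B))"

definition bfo_le :: "nat set \<Rightarrow> nat set \<Rightarrow> bool" (infix \<open>\<le>\<^sub>b\<^sub>f\<^sub>o\<close> 50) where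
  "A \<le>\<^sub>b\<^sub>f\<^sub>o B \<longleftrightarrow>
     (\<exists>f c. computable f \<and> c \<ge> 1 \<and> (\<forall>x. x \<in> A \<longleftrightarrow> f x \<in> B) \<and>
        (\<forall>y. finite (f -` {y}) \<and> card (f -` {y}) \<le> c))"

definition one_equiv :: "nat set \<Rightarrow> nat set \<Rightarrow> bool" (infix \<open>\<equiv>\<^sub>1\<close> 50) where
  "A \<equiv>\<^sub>1 B \<longleftrightarrow> A \<le>\<^sub>1 B \<and> B \<le>\<^sub>1 A"

definition bfo_equiv :: "nat set \<Rightarrow> nat set \<Rightarrow> bool" (infix \<open>\<equiv>\<^sub>b\<^sub>f\<^sub>o\<close> 50) where
  "A \<equiv>\<^sub>b\<^sub>f\<^sub>o B \<longleftrightarrow> A \<le>\<^sub>b\<^sub>f\<^sub>o B \<and> B \<le>\<^sub>b\<^sub>f\<^sub>o A"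

definition one_degree :: "nat set \<Rightarrow> nat set set" where
  "one_degree X = {Y. X \<equiv>\<^sub>1 Y}"

definition bfo_degree :: "nat set \<Rightarrow> nat set set" where
  "bfo_degree X = {Y. X \<equiv>\<^sub>b\<^sub>f\<^sub>o Y}"

definition one_degrees_within :: "nat set set \<Rightarrow> nat set set set" where
  "one_degrees_within D = {d. (\<exists>X. d = one_degree X) \<and> d \<subseteq> D}"

definition one_degree_order :: "nat set set \<Rightarrow> nat set set rel" where
  "one_degree_order D =
     {(one_degree X, one_degree Y) |X Y.
        one_degree X \<subseteq> D \<and> one_degree Y \<subseteq> D \<and> X \<le>\<^sub>1 Y}"

definition order_embedding :: "'a set \<Rightarrow> 'a rel \<Rightarrow> 'b set \<Rightarrow> 'b rel \<Rightarrow> ('a \<Rightarrow> 'b) \<Rightarrow> bool" where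
  "order_embedding A r B s f \<longleftrightarrow>
     (\<forall>x\<in>A. f x \<in> B) \<and> (\<forall>x\<in>A. \<forall>y\<in>A. (x, y) \<in> r \<longleftrightarrow> (f x, f y) \<in> s)"

lemma one_le_refl: "X \<le>\<^sub>1 X"
proof -
  have "run {} (PPair PFst PSnd) x = Some (id x)" for x by simp
  then have "computable id" unfolding computable_in_def by blast
  then show ?thesis unfolding one_le_def by (intro exI[of _ id]) auto
qed

lemma computable_in_comp:
  assumes "computable_in X f" "computable_in X g"
  shows "computable_in X (g \<circ> f)"
proof -
  obtain p q where "\<forall>x. run X p x = Some (f x)" "\<forall>x. run X q x = Some (g x)"
    using assms unfolding computable_in_def by blast
  then have "\<forall>x. run X (PComp q p) x = Some ((g \<circ> f) x)" by simp
  then show ?thesis unfolding computable_in_def by blast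
qed

lemma one_le_trans:
  assumes "X \<le>\<^sub>1 Y" "Y \<le>\<^sub>1 Z"
  shows "X \<le>\<^sub>1 Z"
proof -
  obtain f g where "computable f" "inj f" "\<forall>x. x \<in> X \<longleftrightarrow> f x \<in> Y"
    and "computable g" "inj g" "\<forall>x. x \<in> Y \<longleftrightarrow> g x \<in> Z"
    using assms unfolding one_le_def by blast
  then show ?thesis
    unfolding one_le_def
    by (intro exI[of _ "g \<circ> f"]) (auto intro: computable_in_comp inj_compose)
qed

lemma one_degree_eq_iff: "one_degree X = one_degree Y \<longleftrightarrow> X \<equiv>\<^sub>1 Y"
proof
  assume "one_degree X = one_degree Y"
  moreover have "Y \<in> one_degree Y"
    by (simp add: one_degree_def one_equiv_def one_le_refl)
  ultimately have "Y \<in> one_degree X" by simp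
  then show "X \<equiv>\<^sub>1 Y" by (simp add: one_degree_def)
next
  assume "X \<equiv>\<^sub>1 Y"
  then have "X \<le>\<^sub>1 Y" "Y \<le>\<^sub>1 X" by (simp_all add: one_equiv_def)
  then have "X \<equiv>\<^sub>1 Z \<longleftrightarrow> Y \<equiv>\<^sub>1 Z" for Z
    unfolding one_equiv_def by (meson one_le_trans)
  then show "one_degree X = one_degree Y" by (simp add: one_degree_def)
qed

lemma one_degree_order_iff:
  assumes "one_degree X \<subseteq> D" "one_degree Y \<subseteq> D"
  shows "(one_degree X, one_degree Y) \<in> one_degree_order D \<longleftrightarrow> X \<le>\<^sub>1 Y"
proof
  assume "(one_degree X, one_degree Y) \<in> one_degree_order D"
  then obtain X' Y' where "one_degree X = one_degree X'" "one_degree Y = one_degree Y'" "X' \<le>\<^sub>1 Y'"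
    unfolding one_degree_order_def by auto
  then have "X \<le>\<^sub>1 X'" "X' \<le>\<^sub>1 Y'" "Y' \<le>\<^sub>1 Y"
    by (simp_all add: one_degree_eq_iff one_equiv_def)
  then show "X \<le>\<^sub>1 Y" by (meson one_le_trans)
next
  assume "X \<le>\<^sub>1 Y"
  then show "(one_degree X, one_degree Y) \<in> one_degree_order D"
    unfolding one_degree_order_def using assms by auto
qed

lemma partial_order_on_one_degrees:
  "partial_order_on (one_degrees_within D) (one_degree_order D)"
proof -
  let ?P = "one_degrees_within D" and ?r = "one_degree_order D"
  have sub: "?r \<subseteq> ?P \<times> ?P"
    unfolding one_degree_order_def one_degrees_within_def by auto
  have rep: "\<exists>X. d = one_degree X \<and> one_degree X \<subseteq> D" if "d \<in> ?P" for d
    using that unfolding one_degrees_within_def by auto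
  have refl: "(d, d) \<in> ?r" if "d \<in> ?P" for d
    using rep[OF that] one_le_refl by (auto simp: one_degree_order_iff)
  have trans: "(d, g) \<in> ?r" if "(d, e) \<in> ?r" "(e, g) \<in> ?r" for d e g
  proof -
    have "d \<in> ?P" "e \<in> ?P" "g \<in> ?P" using that sub by auto
    then obtain X Y Z where
      "d = one_degree X" "one_degree X \<subseteq> D" "e = one_degree Y" "one_degree Y \<subseteq> D"
      "g = one_degree Z" "one_degree Z \<subseteq> D"
      using rep[of d] rep[of e] rep[of g] by auto
    then show ?thesis using that one_le_trans[of X Y Z] by (simp add: one_degree_order_iff)
  qed
  have antisym: "d = e" if "(d, e) \<in> ?r" "(e, d) \<in> ?r" for d e
  proof -
    have "d \<in> ?P" "e \<in> ?P" using that sub by auto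
    then obtain X Y where
      "d = one_degree X" "one_degree X \<subseteq> D" "e = one_degree Y" "one_degree Y \<subseteq> D"
      using rep[of d] rep[of e] by auto
    then show ?thesis using that
      by (simp add: one_degree_order_iff one_degree_eq_iff one_equiv_def)
  qed
  show ?thesis
    unfolding partial_order_on_def preorder_on_def
    by (intro conjI sub refl_onI transI antisymI) (fact refl trans antisym | erule (1) trans antisym)+
qed

end

theory Submission
  imports Defs
begin

text \<open>
  Some \<open>A\<close> below the jump of the empty set is rigid: a computable \<open>g\<close> with \<open>A = g\<^sup>-\<^sup>1(A)\<close> fixes all but
  finitely many numbers. It is built by finite extension: at stage \<open>e\<close>, if the \<open>e\<close>-th program
  moves some number beyond the part of \<open>A\<close> decided so far, \<open>A\<close> is made to differ at this number
  and its image. Only total programs matter, so the questions for the jump are the halting of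
  explicitly given programs and no universal program is needed.

  \<open>B\<^sub>i\<close> consists of one copy of \<open>A\<close> and a second copy of \<open>A\<close> on a computable set \<open>S\<^sub>i\<close>, which contains
  the columns strictly below \<open>i\<close> and an infinite part of column \<open>i\<close>. So \<open>S\<^sub>i \<subseteq> S\<^sub>j\<close> if \<open>i\<close>
  is strictly below \<open>j\<close>, whereas \<open>S\<^sub>i - S\<^sub>j\<close> is infinite if \<open>i\<close> is not below \<open>j\<close>, and then rigidity
  of \<open>A\<close> excludes a one-one reduction, because it would have to preserve almost all multiplicities.
\<close>

abbreviation pfst :: "nat \<Rightarrow> nat" where "pfst z \<equiv> fst (prod_decode z)"
abbreviation psnd :: "nat \<Rightarrow> nat" where "psnd z \<equiv> snd (prod_decode z)"

lemma prod_encode_pfst_psnd [simp]: "prod_encode (pfst z, psnd z) = z"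
  by simp

section \<open>Closure properties of relative computability\<close>

named_theorems comp_intros

lemma computable_inI: "(\<And>x. run X p x = Some (f x)) \<Longrightarrow> computable_in X f"
  unfolding computable_in_def by blast

lemma computable_in_compose:
  "computable_in X g \<Longrightarrow> computable_in X f \<Longrightarrow> computable_in X (\<lambda>x. g (f x))"
  using computable_in_comp[of X f g] by (simp add: comp_def)

lemma computable_in_const [comp_intros]: "computable_in X (\<lambda>x. c)"
proof (induction c)
  case 0
  show ?case by (rule computable_inI[of _ PZero]) simp
next
  case (Suc c)
  have "computable_in X Suc" by (rule computable_inI[of _ PSucc]) simp
  then show ?case using Suc by (rule computable_in_compose)
qed

lemma computable_in_id [comp_intros]: "computable_in X (\<lambda>x. x)"
  by (rule computable_inI[of _ "PPair PFst PSnd"]) simp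

lemma computable_in_Suc [comp_intros]:
  "computable_in X f \<Longrightarrow> computable_in X (\<lambda>x. Suc (f x))"
  by (rule computable_in_compose[of X Suc]) (rule computable_inI[of _ PSucc], simp_all)

lemma computable_in_fst [comp_intros]:
  "computable_in X f \<Longrightarrow> computable_in X (\<lambda>x. pfst (f x))"
  by (rule computable_in_compose[of X pfst]) (rule computable_inI[of _ PFst], simp_all)

lemma computable_in_snd [comp_intros]:
  "computable_in X f \<Longrightarrow> computable_in X (\<lambda>x. psnd (f x))"
  by (rule computable_in_compose[of X psnd]) (rule computable_inI[of _ PSnd], simp_all)

lemma computable_in_mem [comp_intros]:
  "computable_in X f \<Longrightarrow> computable_in X (\<lambda>x. of_bool (f x \<in> X))"
  by (rule computable_in_compose[of X "\<lambda>x. of_bool (x \<in> X)"])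
    (rule computable_inI[of _ PQuery], simp_all)

lemma computable_in_pair [comp_intros]:
  assumes "computable_in X f" "computable_in X g"
  shows "computable_in X (\<lambda>x. prod_encode (f x, g x))"
proof -
  obtain p q where "\<And>x. run X p x = Some (f x)" "\<And>x. run X q x = Some (g x)"
    using assms unfolding computable_in_def by blast
  then show ?thesis by (intro computable_inI[of _ "PPair p q"]) simp
qed

text \<open>\<open>PRec\<close> is run on the pair of \<open>x\<close> and \<open>n x\<close>. The
  whole input \<open>x\<close> is thus the parameter of the recursion, and both the start and the
  step may depend on it.\<close>

lemma computable_in_rec_nat [comp_intros]:
  assumes "computable_in X a"
    and "computable_in X (\<lambda>z. b (pfst z) (pfst (psnd z)) (psnd (psnd z)))"
    and "computable_in X n"
  shows "computable_in X (\<lambda>x. rec_nat (a x) (b x) (n x))"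
proof -
  obtain p q where p: "\<And>x. run X p x = Some (a x)"
    and q: "\<And>z. run X q z = Some (b (pfst z) (pfst (psnd z)) (psnd (psnd z)))"
    using assms unfolding computable_in_def by metis
  have "rec_nat (run X p x) (\<lambda>m r. Option.bind r (\<lambda>v. run X q (prod_encode (x, prod_encode (m, v))))) k
    = Some (rec_nat (a x) (b x) k)" for x k
    by (induction k) (simp_all add: p q)
  then have "run X (PRec p q) (prod_encode (x, k)) = Some (rec_nat (a x) (b x) k)" for x k
    by simp
  then have "computable_in X (\<lambda>z. rec_nat (a (pfst z)) (b (pfst z)) (psnd z))"
    by (intro computable_inI[of _ "PRec p q"]) (metis prod_encode_pfst_psnd)
  from computable_in_compose[OF this, of "\<lambda>x. prod_encode (x, n x)"] show ?thesis
    using assms(3) by (simp add: comp_intros)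
qed

lemma computable_in_if [comp_intros]:
  assumes "computable_in X (\<lambda>x. of_bool (P x))" "computable_in X f" "computable_in X g"
  shows "computable_in X (\<lambda>x. if P x then f x else g x)"
proof -
  \<comment> \<open>A case distinction is a recursion of length 0 or 1; both branches are total, so
    evaluating \<open>g x\<close> first is harmless.\<close>
  have "(\<lambda>x. if P x then f x else g x)
      = (\<lambda>x. rec_nat (g x) (\<lambda>_ _. f x) (of_bool (P x)))"
    by auto
  then show ?thesis
    using assms by (auto intro!: comp_intros intro: computable_in_compose[of X f])
qed

lemma computable_in_not [comp_intros]:
  assumes "computable_in X (\<lambda>x. of_bool (P x))"
  shows "computable_in X (\<lambda>x. of_bool (\<not> P x))"
proof -
  have "(\<lambda>x. of_bool (\<not> P x) :: nat) = (\<lambda>x. if P x then 0 else 1)" by auto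
  then show ?thesis using assms by (auto intro!: comp_intros)
qed

lemma computable_in_conj [comp_intros]:
  assumes "computable_in X (\<lambda>x. of_bool (P x))" "computable_in X (\<lambda>x. of_bool (Q x))"
  shows "computable_in X (\<lambda>x. of_bool (P x \<and> Q x))"
proof -
  have "(\<lambda>x. of_bool (P x \<and> Q x) :: nat) = (\<lambda>x. if P x then of_bool (Q x) else 0)" by auto
  then show ?thesis using assms by (auto intro!: comp_intros)
qed

lemma computable_in_disj [comp_intros]:
  assumes "computable_in X (\<lambda>x. of_bool (P x))" "computable_in X (\<lambda>x. of_bool (Q x))"
  shows "computable_in X (\<lambda>x. of_bool (P x \<or> Q x))"
proof -
  have "(\<lambda>x. of_bool (P x \<or> Q x) :: nat) = (\<lambda>x. if P x then 1 else of_bool (Q x))" by auto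
  then show ?thesis using assms by (auto intro!: comp_intros)
qed

lemma computable_in_add [comp_intros]:
  assumes "computable_in X f" "computable_in X g"
  shows "computable_in X (\<lambda>x. f x + g x)"
proof -
  have "rec_nat m (\<lambda>_. Suc) n = m + n" for m n by (induction n) simp_all
  then have "(\<lambda>x. f x + g x) = (\<lambda>x. rec_nat (f x) (\<lambda>_ v. Suc v) (g x))" by simp
  then show ?thesis using assms by (auto intro!: comp_intros)
qed

lemma computable_in_mult [comp_intros]:
  assumes "computable_in X f" "computable_in X g"
  shows "computable_in X (\<lambda>x. f x * g x)"
proof -
  have "rec_nat 0 (\<lambda>_ v. v + m) n = m * n" for m n :: nat by (induction n) simp_all
  then have "(\<lambda>x. f x * g x) = (\<lambda>x. rec_nat 0 (\<lambda>_ v. v + f x) (g x))" by simp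
  then show ?thesis using assms by (auto intro!: comp_intros intro: computable_in_compose[of X f])
qed

lemma computable_in_power [comp_intros]:
  assumes "computable_in X f" "computable_in X g"
  shows "computable_in X (\<lambda>x. f x ^ g x)"
proof -
  have "rec_nat 1 (\<lambda>_ v. v * m) n = m ^ n" for m n :: nat by (induction n) simp_all
  then have "(\<lambda>x. f x ^ g x) = (\<lambda>x. rec_nat 1 (\<lambda>_ v. v * f x) (g x))" by simp
  then show ?thesis using assms by (auto intro!: comp_intros intro: computable_in_compose[of X f])
qed

lemma computable_in_diff [comp_intros]:
  assumes "computable_in X f" "computable_in X g"
  shows "computable_in X (\<lambda>x. f x - g x)"
proof -
  have pred: "rec_nat 0 (\<lambda>m _. m) n = n - 1" for n :: nat by (cases n) simp_all
  have "rec_nat m (\<lambda>_ v. rec_nat 0 (\<lambda>m _. m) v) n = m - n" for m n :: nat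
    by (induction n) (simp_all add: pred)
  then have "(\<lambda>x. f x - g x) = (\<lambda>x. rec_nat (f x) (\<lambda>_ v. rec_nat 0 (\<lambda>m _. m) v) (g x))"
    by simp
  then show ?thesis using assms by (auto intro!: comp_intros)
qed

lemma computable_in_le [comp_intros]:
  assumes "computable_in X f" "computable_in X g"
  shows "computable_in X (\<lambda>x. of_bool (f x \<le> g x))"
proof -
  have "(\<lambda>x. of_bool (f x \<le> g x)) = (\<lambda>x. 1 - (f x - g x))" by (auto simp: of_bool_def)
  then show ?thesis using assms by (auto intro!: comp_intros)
qed

lemma computable_in_less [comp_intros]:
  assumes "computable_in X f" "computable_in X g"
  shows "computable_in X (\<lambda>x. of_bool (f x < g x))"
  unfolding less_eq_Suc_le using assms by (intro comp_intros)

lemma computable_in_eq [comp_intros]: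
  assumes "computable_in X f" "computable_in X g"
  shows "computable_in X (\<lambda>x. of_bool (f x = g x))"
  unfolding order_eq_iff using assms by (intro comp_intros)

lemma run_PMin_neq_None:
  "run X (PMin p) x \<noteq> None \<longleftrightarrow>
     (\<exists>n. run X p (prod_encode (x, n)) = Some 0 \<and>
          (\<forall>m<n. \<exists>k. run X p (prod_encode (x, m)) = Some (Suc k)))"
  by (simp add: Let_def)

text \<open>The test is negated because \<open>PMin\<close> stops at the value 0.\<close>

lemma run_PMin_total:
  assumes "\<And>n. run X p (prod_encode (x, n)) = Some (of_bool (\<not> P n))" "P n0"
  shows "run X (PMin p) x = Some (LEAST n. P n)"
proof -
  let ?stops = "\<lambda>n. P n \<and> (\<forall>m<n. \<not> P m)"
  have stops: "(run X p (prod_encode (x, n)) = Some 0 \<and>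
          (\<forall>m<n. \<exists>k. run X p (prod_encode (x, m)) = Some (Suc k))) \<longleftrightarrow> ?stops n" for n
    by (auto simp: assms(1) of_bool_def split: if_splits)
  have least: "?stops (LEAST n. P n)"
    using assms(2) by (auto intro: LeastI dest: not_less_Least)
  have the: "(THE n. ?stops n) = (LEAST n. P n)"
  proof (rule the_equality)
    show "?stops (LEAST n. P n)" by (fact least)
    show "n = (LEAST n. P n)" if "?stops n" for n
      using that by (intro Least_equality[symmetric]) (auto simp: not_less[symmetric])
  qed
  have "\<exists>n. ?stops n" using least by (rule exI)
  then show ?thesis by (simp only: run.simps stops Let_def the if_True)
qed

lemma computable_in_Least [comp_intros]:
  assumes "computable_in X (\<lambda>z. of_bool (P (pfst z) (psnd z)))"
    and "\<And>x. \<exists>n. P x n"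
  shows "computable_in X (\<lambda>x. LEAST n. P x n)"
proof -
  have "computable_in X (\<lambda>z. of_bool (\<not> P (pfst z) (psnd z)))"
    using assms(1) by (rule computable_in_not)
  then obtain p where p: "\<And>z. run X p z = Some (of_bool (\<not> P (pfst z) (psnd z)))"
    unfolding computable_in_def by blast
  have "run X (PMin p) x = Some (LEAST n. P x n)" for x
    using assms(2)[of x] by (elim exE, intro run_PMin_total) (simp_all add: p)
  then show ?thesis by (rule computable_inI)
qed

text \<open>Membership means that the quotient of the code by a power of 2 is odd. The quotient is
  found by unbounded search, and parity is reduced to halving and comparison.\<close>

lemma computable_in_mem_set_decode [comp_intros]:
  assumes "computable_in X f" "computable_in X g"
  shows "computable_in X (\<lambda>x. of_bool (f x \<in> set_decode (g x)))"
proof -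
  have div_eq: "m div d = (LEAST q. m < Suc q * d)" if "d > 0" for m d :: nat
  proof (rule Least_equality[symmetric])
    show "m < Suc (m div d) * d"
      using dividend_less_div_times[OF that, of m] by simp
    show "m div d \<le> q" if "m < Suc q * d" for q
      using less_mult_imp_div_less[OF that] by simp
  qed
  have div: "computable_in X (\<lambda>x. a x div b x)"
    if "computable_in X a" "computable_in X b" "\<And>x. b x > 0" for a b
  proof -
    have "\<exists>n. a x < Suc n * b x" for x
      using dividend_less_div_times[OF that(3)[of x], of "a x"]
      by (intro exI[of _ "a x div b x"]) simp
    then show ?thesis
      unfolding div_eq[OF that(3)]
      by (intro comp_intros computable_in_compose[OF that(1)] computable_in_compose[OF that(2)])
  qed
  have odd: "odd n \<longleftrightarrow> 2 * (n div 2) < n" for n :: nat by presburger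
  show ?thesis
    unfolding set_decode_def mem_Collect_eq odd
    using assms by (intro comp_intros div) simp_all
qed

section \<open>Queries to the jump\<close>

lemma index_of_mem_turing_jump:
  "index_of p \<in> turing_jump X \<longleftrightarrow> run X p (index_of p) \<noteq> None"
  using inj_index_of by (auto simp: turing_jump_def inj_eq)

text \<open>This hardwires a number into a program and so replaces the s-m-n theorem: the index of
  the result is an explicit recursion in \<open>k\<close>.\<close>

definition PShift :: "nat \<Rightarrow> program \<Rightarrow> program" where
  "PShift k p = (PComp PSucc ^^ k) p"

lemma run_PShift: "run X p x = Some y \<Longrightarrow> run X (PShift k p) x = Some (y + k)"
  by (induction k) (simp_all add: PShift_def)

lemma index_of_PShift:
  "index_of (PShift k p) = rec_nat (index_of p) (\<lambda>_ v. 6 + 4 * prod_encode (1, v)) k"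
  by (induction k) (simp_all add: PShift_def)

text \<open>The program \<open>d\<close> below ignores its input, so halting on its own index means
  halting at all. Its search stops at once if \<open>p\<close> yields \<open>m\<close> on
  \<open>n\<close>; otherwise the test diverges or returns 1 forever.\<close>

lemma jump_decides_graph:
  obtains K where
    "\<And>Y e n m. computable_in Y e \<Longrightarrow> computable_in Y n \<Longrightarrow> computable_in Y m \<Longrightarrow>
       computable_in Y (\<lambda>x. K (e x) (n x) (m x))"
    and "\<And>p n m. K (index_of p) n m \<in> turing_jump X \<longleftrightarrow> run X p n = Some m"
proof -
  have "computable_in X (\<lambda>z. of_bool (pfst z \<noteq> psnd z))" by (intro comp_intros)
  then obtain q where q: "\<And>z. run X q z = Some (of_bool (pfst z \<noteq> psnd z))"
    unfolding computable_in_def by blast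
  \<comment> \<open>\<open>S k\<close> is the index of \<open>PShift k PZero\<close>: 0 is the index
    of \<open>PZero\<close>, 1 that of \<open>PSucc\<close>, and 6 is the tag of
    \<open>PComp\<close>. In the same way \<open>K\<close> spells out the index of
    \<open>d\<close>.\<close>
  define S where "S = (\<lambda>k. rec_nat 0 (\<lambda>_ v. 6 + 4 * prod_encode (1, v)) k :: nat)"
  define K where "K = (\<lambda>e n m. 8 + 4 * (6 + 4 * prod_encode (index_of q,
    5 + 4 * prod_encode (6 + 4 * prod_encode (e, S n), S m))))"
  show ?thesis
  proof (rule that[of K])
    show "computable_in Y (\<lambda>x. K (e x) (n x) (m x))"
      if "computable_in Y e" "computable_in Y n" "computable_in Y m" for Y e n m
      unfolding K_def S_def using that by (intro comp_intros)
    fix p n m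
    define d where "d = PMin (PComp q (PPair (PComp p (PShift n PZero)) (PShift m PZero)))"
    have "run X (PShift k PZero) x = Some k" for k x
      using run_PShift[of X PZero x 0 k] by simp
    then have "run X d x \<noteq> None \<longleftrightarrow> run X p n = Some m" for x
      unfolding d_def run_PMin_neq_None by (cases "run X p n") (auto simp: q of_bool_def)
    moreover have "index_of d = K (index_of p) n m"
      by (simp add: d_def K_def S_def index_of_PShift)
    ultimately show "K (index_of p) n m \<in> turing_jump X \<longleftrightarrow> run X p n = Some m"
      using index_of_mem_turing_jump[of d X] by simp
  qed
qed

text \<open>
  For a program that is not total the query below may answer no although there is a
  non-fixed point: the search it asks about runs sequentially.
\<close>

lemma jump_detects_non_fixed_point:
  obtains Q where
    "\<And>Y e w. computable_in Y e \<Longrightarrow> computable_in Y w \<Longrightarrow> computable_in Y (\<lambda>x. Q (e x) (w x))"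
    and "\<And>p w. Q (index_of p) w \<in> turing_jump X \<Longrightarrow> \<exists>n\<ge>w. \<exists>m. m \<noteq> n \<and> run X p n = Some m"
    and "\<And>p w g n. \<lbrakk>\<And>x. run X p x = Some (g x); w \<le> n; g n \<noteq> n\<rbrakk> \<Longrightarrow>
           Q (index_of p) w \<in> turing_jump X"
proof -
  have "computable_in X (\<lambda>z. of_bool (pfst z = psnd z))" by (intro comp_intros)
  then obtain q where q: "\<And>z. run X q z = Some (of_bool (pfst z = psnd z))"
    unfolding computable_in_def by blast
  \<comment> \<open>The start 3 is the index of \<open>PSnd\<close>. The program
    \<open>PShift w PSnd\<close> sends \<open>prod_encode (x, n)\<close> to \<open>n + w\<close>, so
    the search of \<open>d\<close> runs through the numbers from \<open>w\<close> on.\<close>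
  define S where "S = (\<lambda>k. rec_nat 3 (\<lambda>_ v. 6 + 4 * prod_encode (1, v)) k :: nat)"
  define Q where "Q = (\<lambda>e w. 8 + 4 * (6 + 4 * prod_encode (index_of q,
    5 + 4 * prod_encode (6 + 4 * prod_encode (e, S w), S w))))"
  define d where
    "d = (\<lambda>p w. PMin (PComp q (PPair (PComp p (PShift w PSnd)) (PShift w PSnd))))"
  have index_d: "Q (index_of p) w = index_of (d p w)" for p w
    by (simp add: d_def Q_def S_def index_of_PShift)
  have shift: "run X (PShift w PSnd) (prod_encode (x, n)) = Some (n + w)" for w x n
    by (intro run_PShift) simp
  show ?thesis
  proof (rule that[of Q])
    show "computable_in Y (\<lambda>x. Q (e x) (w x))"
      if "computable_in Y e" "computable_in Y w" for Y e w
      unfolding Q_def S_def using that by (intro comp_intros)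
  next
    fix p w
    assume "Q (index_of p) w \<in> turing_jump X"
    then have "run X (d p w) (index_of (d p w)) \<noteq> None"
      by (simp add: index_d index_of_mem_turing_jump)
    then obtain n where "run X (PComp q (PPair (PComp p (PShift w PSnd)) (PShift w PSnd)))
        (prod_encode (index_of (d p w), n)) = Some 0"
      unfolding d_def run_PMin_neq_None by blast
    then obtain m where "run X p (n + w) = Some m" "m \<noteq> n + w"
      by (auto simp: shift q bind_eq_Some_conv)
    then show "\<exists>n\<ge>w. \<exists>m. m \<noteq> n \<and> run X p n = Some m"
      by (intro exI[of _ "n + w"]) auto
  next
    fix p w g n
    assume g: "\<And>x. run X p x = Some (g x)" and n: "w \<le> n" "g n \<noteq> n"
    have "run X (d p w) x = Some (LEAST n. g (n + w) \<noteq> n + w)" for x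
      unfolding d_def
    proof (rule run_PMin_total)
      show "g (n - w + w) \<noteq> n - w + w" using n by simp
    qed (simp add: shift g q)
    then show "Q (index_of p) w \<in> turing_jump X"
      by (simp add: index_d index_of_mem_turing_jump)
  qed
qed

text \<open>Instead of simulating a program, one searches through pairs and lets the jump check that
  the second component is the value at the first. If the query \<open>Q\<close> is negative, a
  default pair is accepted, so \<open>N\<close> is total for every index.\<close>

lemma jump_finds_non_fixed_point:
  obtains N where
    "computable_in (turing_jump X) (\<lambda>x. N (pfst x) (psnd x))"
    and "\<And>e w. w \<le> pfst (N e w)"
    and "\<And>e w. pfst (N e w) \<noteq> psnd (N e w)"
    and "\<And>p w g n. \<lbrakk>\<And>x. run X p x = Some (g x); w \<le> n; g n \<noteq> n\<rbrakk> \<Longrightarrow>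
           psnd (N (index_of p) w) = g (pfst (N (index_of p) w))"
proof -
  obtain K where K_comp [comp_intros]: "\<And>Y e n m. computable_in Y e \<Longrightarrow> computable_in Y n \<Longrightarrow>
        computable_in Y m \<Longrightarrow> computable_in Y (\<lambda>x. K (e x) (n x) (m x))"
    and K: "\<And>p n m. K (index_of p) n m \<in> turing_jump X \<longleftrightarrow> run X p n = Some m"
    using jump_decides_graph[of X] by blast
  obtain Q where Q_comp [comp_intros]: "\<And>Y e w. computable_in Y e \<Longrightarrow> computable_in Y w \<Longrightarrow>
        computable_in Y (\<lambda>x. Q (e x) (w x))"
    and Q1: "\<And>p w. Q (index_of p) w \<in> turing_jump X \<Longrightarrow> \<exists>n\<ge>w. \<exists>m. m \<noteq> n \<and> run X p n = Some m"
    and Q2: "\<And>p w g n. \<lbrakk>\<And>x. run X p x = Some (g x); w \<le> n; g n \<noteq> n\<rbrakk> \<Longrightarrow>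
           Q (index_of p) w \<in> turing_jump X"
    using jump_detects_non_fixed_point[of X] by blast
  define R where "R = (\<lambda>e w z. w \<le> pfst z \<and> pfst z \<noteq> psnd z \<and>
    (Q e w \<notin> turing_jump X \<or> K e (pfst z) (psnd z) \<in> turing_jump X))"
  have R_ex: "\<exists>z. R e w z" for e w
  proof -
    obtain p where p: "e = index_of p" using surj_index_of by (metis surjD)
    show ?thesis
    proof (cases "Q e w \<in> turing_jump X")
      case True
      then obtain n m where "w \<le> n" "m \<noteq> n" "run X p n = Some m" using Q1 p by blast
      then show ?thesis
        unfolding R_def p by (intro exI[of _ "prod_encode (n, m)"]) (simp add: K)
    next
      case False
      then show ?thesis unfolding R_def by (intro exI[of _ "prod_encode (w, Suc w)"]) simp
    qed
  qed
  define N where "N = (\<lambda>e w. LEAST z. R e w z)"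
  have R_N: "R e w (N e w)" for e w unfolding N_def using R_ex by (rule LeastI_ex)
  show ?thesis
  proof (rule that[of N])
    show "computable_in (turing_jump X) (\<lambda>x. N (pfst x) (psnd x))"
      unfolding N_def
    proof (rule computable_in_Least)
      show "computable_in (turing_jump X) (\<lambda>z. of_bool (R (pfst (pfst z)) (psnd (pfst z)) (psnd z)))"
        unfolding R_def by (intro comp_intros)
    qed (rule R_ex)
    show "w \<le> pfst (N e w)" "pfst (N e w) \<noteq> psnd (N e w)" for e w
      using R_N[of e w] by (simp_all add: R_def)
    fix p w g n
    assume g: "\<And>x. run X p x = Some (g x)" and "w \<le> n" "g n \<noteq> n"
    then have "Q (index_of p) w \<in> turing_jump X" by (rule Q2)
    then show "psnd (N (index_of p) w) = g (pfst (N (index_of p) w))"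
      using R_N[of "index_of p" w] by (simp add: R_def K g)
  qed
qed

section \<open>A rigid set below the jump\<close>

text \<open>
  The code \<open>w\<close> of a finite set is at the same time a bound for its elements, and it stands for
  the decision of membership below \<open>w\<close>. Including \<open>Suc v\<close> makes the new code exceed \<open>v\<close> even
  if \<open>v\<close> itself is left out.
\<close>

definition separate :: "nat \<Rightarrow> nat \<Rightarrow> nat \<Rightarrow> nat" where
  "separate w u v = w + 2 ^ Suc v + (if u \<in> set_decode w then 0 else 2 ^ v)"

lemma less_if_mem_set_decode:
  assumes "x \<in> set_decode w"
  shows "x < w"
proof -
  have "w div 2 ^ x \<noteq> 0" using assms by (auto simp: set_decode_def elim: oddE)
  then have "2 ^ x \<le> w" by (simp add: div_eq_0_iff)
  then show ?thesis using less_exp[of x] by linarith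
qed

lemma separate_gt: "Suc v < separate w u v"
  using less_exp[of "Suc v"] by (simp add: separate_def)

text \<open>All elements of \<open>set_decode w\<close> are below \<open>w\<close>, hence below the
  new ones, so adding the powers of 2 causes no carry.\<close>

lemma set_decode_separate:
  assumes "w \<le> v"
  shows "set_decode (separate w u v) =
    set_decode w \<union> {Suc v} \<union> (if u \<in> set_decode w then {} else {v})"
proof -
  let ?D = "set_decode w"
  have new: "v \<notin> ?D" "Suc v \<notin> ?D" using assms by (auto dest: less_if_mem_set_decode)
  have "set_encode (insert (Suc v) ?D) = 2 ^ Suc v + w"
    using set_encode_insert[OF finite_set_decode new(2)] by simp
  moreover have "set_encode (insert v (insert (Suc v) ?D)) = 2 ^ v + (2 ^ Suc v + w)"
    using set_encode_insert[of "insert (Suc v) ?D" v] new calculation by simp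
  ultimately have "separate w u v =
      set_encode (?D \<union> {Suc v} \<union> (if u \<in> ?D then {} else {v}))"
    by (simp add: separate_def insert_commute)
  then show ?thesis by (simp add: set_encode_inverse)
qed

lemma computable_in_separate [comp_intros]:
  "computable_in X w \<Longrightarrow> computable_in X u \<Longrightarrow> computable_in X v \<Longrightarrow>
     computable_in X (\<lambda>x. separate (w x) (u x) (v x))"
  unfolding separate_def by (intro comp_intros)

theorem rigid_set_below_jump:
  obtains A where "A \<le>\<^sub>T turing_jump X"
    and "\<And>g. computable_in X g \<Longrightarrow> (\<And>x. x \<in> A \<longleftrightarrow> g x \<in> A) \<Longrightarrow> finite {x. g x \<noteq> x}"
proof -
  let ?J = "turing_jump X"
  obtain N where N_comp: "computable_in ?J (\<lambda>x. N (pfst x) (psnd x))"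
    and N_ge: "\<And>e w. w \<le> pfst (N e w)"
    and N_neq: "\<And>e w. pfst (N e w) \<noteq> psnd (N e w)"
    and N_val: "\<And>p w g n. \<lbrakk>\<And>x. run X p x = Some (g x); w \<le> n; g n \<noteq> n\<rbrakk> \<Longrightarrow>
           psnd (N (index_of p) w) = g (pfst (N (index_of p) w))"
    using jump_finds_non_fixed_point[of X] by blast
  \<comment> \<open>Only the first component of \<open>N e w\<close> is known to be at least
    \<open>w\<close>; the other may be decided already. Ordering the pair ensures that the number to
    be put in or left out is still undecided.\<close>
  define lo where "lo = (\<lambda>z. if pfst z \<le> psnd z then pfst z else psnd z)"
  define hi where "hi = (\<lambda>z. if pfst z \<le> psnd z then psnd z else pfst z)"
  define step where "step = (\<lambda>e w. separate w (lo (N e w)) (hi (N e w)))"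
  define W where "W = rec_nat 0 step"
  \<comment> \<open>\<open>W (Suc x)\<close> exceeds \<open>x\<close>, so this stage has decided
    \<open>x\<close>.\<close>
  define A where "A = {x. x \<in> set_decode (W (Suc x))}"
  have W_Suc: "W (Suc e) = step e (W e)" for e by (simp add: W_def)
  have hi_ge: "w \<le> hi (N e w)" and lo_less: "lo (N e w) < hi (N e w)" for e w
    using N_ge[where e=e and w=w] N_neq[where e=e and w=w] by (auto simp: lo_def hi_def)
  have hi_less: "hi (N e (W e)) < W (Suc e)" for e
    using Suc_lessD[OF separate_gt] by (simp add: W_Suc step_def)
  have W_less: "W e < W (Suc e)" for e
    using hi_ge hi_less le_less_trans by blast
  then have "strict_mono W" by (simp add: strict_mono_Suc_iff)
  then have W_ge: "e \<le> W e" for e by (rule strict_mono_imp_increasing)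
  have W_mono: "W e \<le> W d" if "e \<le> d" for e d
    using \<open>strict_mono W\<close> that by (simp add: strict_mono_less_eq)
  have decode_step: "set_decode (W (Suc e)) = set_decode (W e) \<union> {Suc (hi (N e (W e)))} \<union>
      (if lo (N e (W e)) \<in> set_decode (W e) then {} else {hi (N e (W e))})" for e
    unfolding W_Suc step_def by (rule set_decode_separate[OF hi_ge])
  have stable: "x \<in> set_decode (W d) \<longleftrightarrow> x \<in> set_decode (W e)" if "x < W e" "e \<le> d" for x d e
    using that(2)
  proof (induction rule: dec_induct)
    case (step d)
    have "x < hi (N d (W d))"
      using that(1) W_mono[OF step(1)] hi_ge[of "W d" d] by linarith
    then show ?case using step.IH by (auto simp: decode_step)
  qed simp
  have A_iff: "x \<in> A \<longleftrightarrow> x \<in> set_decode (W e)" if "x < W e" for x e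
  proof -
    have "x < W (Suc x)" using W_ge[of "Suc x"] by simp
    then show ?thesis using stable that by (metis A_def mem_Collect_eq nat_le_linear)
  qed
  show ?thesis
  proof (rule that)
    have N_comp' [comp_intros]: "computable_in ?J (\<lambda>x. N (e x) (w x))"
      if "computable_in ?J e" "computable_in ?J w" for e w
      using computable_in_compose[OF N_comp computable_in_pair[OF that]] by simp
    have "computable_in ?J (\<lambda>x. of_bool (x \<in> A))"
      unfolding A_def mem_Collect_eq W_def step_def lo_def hi_def by (intro comp_intros)
    then show "A \<le>\<^sub>T ?J" by (simp add: turing_le_def)
  next
    fix g
    assume "computable_in X g" and inv: "\<And>x. x \<in> A \<longleftrightarrow> g x \<in> A"
    then obtain p where p: "\<And>x. run X p x = Some (g x)" unfolding computable_in_def by blast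
    show "finite {x. g x \<noteq> x}"
    proof (rule ccontr)
      assume inf: "infinite {x. g x \<noteq> x}"
      define e where "e = index_of p"
      define z where "z = N e (W e)"
      obtain n where "W e \<le> n" "g n \<noteq> n"
        using inf unfolding finite_nat_set_iff_bounded mem_Collect_eq Ball_def by (meson not_le)
      then have val: "psnd z = g (pfst z)" unfolding z_def e_def by (rule N_val[OF p])
      have z: "W e \<le> hi z" "lo z < hi z" "hi z < W (Suc e)"
        unfolding z_def by (rule hi_ge lo_less hi_less)+
      \<comment> \<open>If \<open>lo z\<close> is undecided too, it stays outside, because the stage
        adds nothing below \<open>hi z\<close>.\<close>
      have "hi z \<notin> set_decode (W e)" using z by (auto dest: less_if_mem_set_decode)
      then have "hi z \<in> set_decode (W (Suc e)) \<longleftrightarrow> lo z \<notin> set_decode (W (Suc e))"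
        using z by (auto simp: decode_step z_def[symmetric])
      then have "hi z \<in> A \<longleftrightarrow> lo z \<notin> A"
        using z A_iff[of "hi z" "Suc e"] A_iff[of "lo z" "Suc e"] by simp
      then show False using inv[of "pfst z"] val by (auto simp: lo_def hi_def split: if_splits)
    qed
  qed
qed

section \<open>Bounded finite-one reducibility\<close>

lemma one_le_imp_bfo_le:
  assumes "X \<le>\<^sub>1 Y"
  shows "X \<le>\<^sub>b\<^sub>f\<^sub>o Y"
proof -
  obtain f where f: "computable f" "inj f" "\<forall>x. x \<in> X \<longleftrightarrow> f x \<in> Y"
    using assms unfolding one_le_def by blast
  have "finite (f -` {y}) \<and> card (f -` {y}) \<le> 1" for y
    using f(2) card_vimage_inj_on_le[of f UNIV "{y}"] finite_vimageI[of "{y}" f] by simp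
  then show ?thesis unfolding bfo_le_def using f by (intro exI[of _ f] exI[of _ 1]) simp
qed

lemma bfo_le_trans:
  assumes "X \<le>\<^sub>b\<^sub>f\<^sub>o Y" "Y \<le>\<^sub>b\<^sub>f\<^sub>o Z"
  shows "X \<le>\<^sub>b\<^sub>f\<^sub>o Z"
proof -
  obtain f c where f: "computable f" "c \<ge> 1" "\<forall>x. x \<in> X \<longleftrightarrow> f x \<in> Y"
      "\<And>y. finite (f -` {y})" "\<And>y. card (f -` {y}) \<le> c"
    using assms(1) unfolding bfo_le_def by blast
  obtain g d where g: "computable g" "d \<ge> 1" "\<forall>x. x \<in> Y \<longleftrightarrow> g x \<in> Z"
      "\<And>y. finite (g -` {y})" "\<And>y. card (g -` {y}) \<le> d"
    using assms(2) unfolding bfo_le_def by blast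
  have fibre: "(g \<circ> f) -` {y} = (\<Union>z\<in>g -` {y}. f -` {z})" for y by auto
  have "card ((g \<circ> f) -` {y}) \<le> d * c" for y
  proof -
    have "card ((g \<circ> f) -` {y}) \<le> (\<Sum>z\<in>g -` {y}. card (f -` {z}))"
      unfolding fibre by (rule card_UN_le[OF g(4)])
    also have "\<dots> \<le> card (g -` {y}) * c"
      using sum_bounded_above[of "g -` {y}" "\<lambda>z. card (f -` {z})" c] f(5) by simp
    also have "\<dots> \<le> d * c" using g(5) by simp
    finally show ?thesis .
  qed
  moreover have "finite ((g \<circ> f) -` {y})" for y
    unfolding fibre using f(4) g(4) by blast
  moreover have "d * c \<ge> 1" using f(2) g(2) by simp
  ultimately show ?thesis
    unfolding bfo_le_def
    using f(1,3) g(1,3) computable_in_comp by (intro exI[of _ "g \<circ> f"] exI[of _ "d * c"]) simp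
qed

lemma one_degree_subset_bfo_degree:
  assumes "X \<equiv>\<^sub>b\<^sub>f\<^sub>o A"
  shows "one_degree X \<subseteq> bfo_degree A"
  using assms unfolding one_degree_def bfo_degree_def one_equiv_def bfo_equiv_def
  by (auto intro: bfo_le_trans one_le_imp_bfo_le)

section \<open>Duplicating columns\<close>

text \<open>
  \<open>dup r i\<close> enumerates \<open>S\<^sub>i\<close> injectively. The columns not strictly below \<open>i\<close> are moved into column
  \<open>i\<close>, so that \<open>dup r j\<close> is the identity on \<open>S\<^sub>i\<close> for \<open>i\<close> strictly below \<open>j\<close>.
  In \<open>base r i\<close> the numbers \<open>\<langle>0,x\<rangle>\<close> represent the first copy of \<open>A\<close>, all others the second.
\<close>

definition dup :: "nat rel \<Rightarrow> nat \<Rightarrow> nat \<Rightarrow> nat" where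
  "dup r i z = (if (pfst z, i) \<in> r \<and> pfst z \<noteq> i then z else prod_encode (i, z))"

definition copy :: "nat \<Rightarrow> nat" where
  "copy z = prod_encode (Suc (pfst z), psnd z)"

definition base :: "nat rel \<Rightarrow> nat \<Rightarrow> nat \<Rightarrow> nat" where
  "base r i x = (if pfst x = 0 then psnd x else dup r i (prod_encode (pfst x - 1, psnd x)))"

text \<open>Moved numbers land in column \<open>i\<close>, while numbers left in place lie in other
  columns.\<close>

lemma dup_inject: "dup r i y = dup r i z \<longleftrightarrow> y = z"
  by (auto simp: dup_def prod_encode_eq split: if_splits)

lemma copy_inject [simp]: "copy y = copy z \<longleftrightarrow> y = z"
proof -
  have "copy y = copy z \<longleftrightarrow> prod_decode y = prod_decode z"
    by (simp add: copy_def prod_encode_eq prod_eq_iff)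
  then show ?thesis by (simp add: prod_decode_eq)
qed

lemma pfst_copy [simp]: "pfst (copy z) = Suc (pfst z)"
  by (simp add: copy_def)

lemma zero_neq_copy [simp]: "prod_encode (0, x) \<noteq> copy z" "copy z \<noteq> prod_encode (0, x)"
  by (simp_all add: copy_def prod_encode_eq)

lemma base_zero [simp]: "base r i (prod_encode (0, x)) = x"
  by (simp add: base_def)

lemma base_copy [simp]: "base r i (copy z) = dup r i z"
  by (simp add: base_def copy_def)

lemma zero_or_copy_cases:
  obtains (zero) x where "c = prod_encode (0, x)" | (copy) z where "c = copy z"
proof (cases "pfst c")
  case 0
  have "c = prod_encode (0, psnd c)" using prod_encode_pfst_psnd[of c] unfolding 0 by (rule sym)
  then show ?thesis by (rule zero)
next
  case (Suc k)
  have "copy (prod_encode (k, psnd c)) = prod_encode (pfst c, psnd c)"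
    by (simp only: copy_def Suc prod_encode_inverse fst_conv snd_conv)
  then have "c = copy (prod_encode (k, psnd c))" by simp
  then show ?thesis by (rule copy)
qed

text \<open>If \<open>y\<close> is the value of \<open>dup r i\<close> at \<open>z\<close>, then
  \<open>z\<close> is \<open>y\<close> when left in place and \<open>psnd y\<close> when
  moved.\<close>

lemma base_vimage_subset:
  "base r i -` {y} \<subseteq> {prod_encode (0, y), copy y, copy (psnd y)}"
proof
  fix c
  assume "c \<in> base r i -` {y}"
  then show "c \<in> {prod_encode (0, y), copy y, copy (psnd y)}"
    by (cases c rule: zero_or_copy_cases) (auto simp: dup_def split: if_splits)
qed

lemma computable_copy [comp_intros]:
  "computable_in X f \<Longrightarrow> computable_in X (\<lambda>x. copy (f x))"
  unfolding copy_def by (intro comp_intros)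

lemma computable_dup:
  assumes "computable_set (prod_encode ` r)" "computable f"
  shows "computable (\<lambda>x. dup r i (f x))"
proof -
  have "computable (\<lambda>x. of_bool (prod_encode (pfst (f x), i) \<in> prod_encode ` r))"
    by (rule computable_in_compose[OF assms(1)[unfolded computable_set_def]])
      (intro comp_intros assms(2))
  then have "computable (\<lambda>x. of_bool ((pfst (f x), i) \<in> r))"
    by (simp add: inj_image_mem_iff[OF inj_prod_encode])
  then show ?thesis unfolding dup_def by (intro comp_intros assms(2))
qed

lemma computable_base:
  assumes "computable_set (prod_encode ` r)" "computable f"
  shows "computable (\<lambda>x. base r i (f x))"
  unfolding base_def by (intro comp_intros computable_dup assms)

lemma base_vimage_bfo_equiv:
  assumes "computable_set (prod_encode ` r)"
  shows "base r i -` A \<equiv>\<^sub>b\<^sub>f\<^sub>o A"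
proof -
  have "A \<le>\<^sub>1 base r i -` A"
    unfolding one_le_def
    by (intro exI[of _ "\<lambda>x. prod_encode (0, x)"] conjI comp_intros) (auto simp: inj_def)
  moreover have "base r i -` A \<le>\<^sub>b\<^sub>f\<^sub>o A"
    unfolding bfo_le_def
  proof (intro exI[of _ "base r i"] exI[of _ 3] conjI allI)
    show "computable (base r i)" using computable_base[OF assms computable_in_id] by simp
    fix y
    show "finite (base r i -` {y})" by (rule finite_subset[OF base_vimage_subset]) simp
    have "card (base r i -` {y}) \<le> card {prod_encode (0, y), copy y, copy (psnd y)}"
      by (rule card_mono[OF _ base_vimage_subset]) simp
    also have "\<dots> \<le> 3" by (simp add: card_insert_if)
    finally show "card (base r i -` {y}) \<le> 3" .
  qed simp_all
  ultimately show ?thesis by (simp add: bfo_equiv_def one_le_imp_bfo_le)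
qed

text \<open>For \<open>i\<close> strictly below \<open>j\<close>, the duplicate of a number goes to
  the copy position with that number itself as label, since \<open>dup r j\<close> fixes the range
  of \<open>dup r i\<close>.\<close>

lemma base_vimage_one_le:
  assumes "partial_order_on UNIV r" "computable_set (prod_encode ` r)" "(i, j) \<in> r"
  shows "base r i -` A \<le>\<^sub>1 base r j -` A"
proof (cases "i = j")
  case True
  then show ?thesis by (simp add: one_le_refl)
next
  case False
  have "trans r" "antisym r"
    using assms(1) by (simp_all add: partial_order_on_def preorder_on_def)
  \<comment> \<open>If \<open>k = j\<close>, then \<open>i\<close> and \<open>j\<close> would be
    below each other, contradicting antisymmetry.\<close>
  have "(k, j) \<in> r \<and> k \<noteq> j" if "(k, i) \<in> r" for k
    using transD[OF \<open>trans r\<close> that assms(3)] antisymD[OF \<open>antisym r\<close> assms(3)] that False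
    by blast
  then have below: "(pfst (dup r i z), j) \<in> r \<and> pfst (dup r i z) \<noteq> j" for z
    using False assms(3) by (simp add: dup_def)
  have dup_dup: "dup r j (dup r i z) = dup r i z" for z
    unfolding dup_def[of r j] using below by simp
  define f where "f = (\<lambda>x. if pfst x = 0 then x else copy (base r i x))"
  have f_zero: "f (prod_encode (0, x)) = prod_encode (0, x)" for x by (simp add: f_def)
  have f_copy: "f (copy z) = copy (dup r i z)" for z by (simp add: f_def)
  have "computable f"
    unfolding f_def by (intro comp_intros computable_base assms(2))
  moreover have "inj f"
  proof (rule injI)
    fix x y
    assume eq: "f x = f y"
    show "x = y"
      using eq by (cases x rule: zero_or_copy_cases; cases y rule: zero_or_copy_cases)
        (simp_all add: f_zero f_copy dup_inject)
  qed
  moreover have "base r j (f x) = base r i x" for x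
    by (cases x rule: zero_or_copy_cases) (simp_all add: f_zero f_copy dup_dup)
  ultimately show ?thesis unfolding one_le_def by (intro exI[of _ f]) simp
qed

text \<open>
  A one-one reduction would have to send both the original and the duplicate of almost every
  \<open>\<langle>i,\<langle>i,n\<rangle>\<rangle>\<close> to a representative of the same number, but this number has no
  duplicate in the second set.
\<close>

lemma base_vimage_one_le_imp:
  assumes rigid: "\<And>g. computable g \<Longrightarrow> (\<And>x. x \<in> A \<longleftrightarrow> g x \<in> A) \<Longrightarrow> finite {x. g x \<noteq> x}"
    and "refl r" and r: "computable_set (prod_encode ` r)"
    and le: "base r i -` A \<le>\<^sub>1 base r j -` A"
  shows "(i, j) \<in> r"
proof (rule ccontr)
  assume ij: "(i, j) \<notin> r"
  have "i \<noteq> j" using ij reflD[OF \<open>refl r\<close>, of i] by blast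
  obtain f where f: "computable f" "inj f" "\<And>x. base r i x \<in> A \<longleftrightarrow> base r j (f x) \<in> A"
    using le unfolding one_le_def vimage_eq by blast
  have f_comp: "computable (\<lambda>x. f (h x))" if "computable h" for h
    using f(1) that by (rule computable_in_compose)
  define g0 where "g0 = (\<lambda>x. base r j (f (prod_encode (0, x))))"
  \<comment> \<open>Where a number has the duplicate \<open>copy (psnd x)\<close>, \<open>g1\<close>
    follows its image under \<open>f\<close>; elsewhere it is the identity, so that rigidity applies
    to a total map.\<close>
  define g1 where
    "g1 = (\<lambda>x. if pfst x = i \<and> pfst (psnd x) = i then base r j (f (copy (psnd x))) else x)"
  have dup_diag: "dup r i (psnd x) = x" if "pfst x = i" "pfst (psnd x) = i" for x
    using that by (auto simp: dup_def)
  have "finite {x. g0 x \<noteq> x}"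
  proof (rule rigid)
    show "computable g0"
      unfolding g0_def by (intro comp_intros computable_base r f_comp)
    show "x \<in> A \<longleftrightarrow> g0 x \<in> A" for x
      using f(3)[of "prod_encode (0, x)"] by (simp add: g0_def)
  qed
  moreover have "finite {x. g1 x \<noteq> x}"
  proof (rule rigid)
    show "computable g1"
      unfolding g1_def by (intro comp_intros computable_base r f_comp)
    show "x \<in> A \<longleftrightarrow> g1 x \<in> A" for x
      using f(3)[of "copy (psnd x)"] dup_diag[of x] by (auto simp: g1_def)
  qed
  ultimately have "finite ({x. g0 x \<noteq> x} \<union> {x. g1 x \<noteq> x})" by simp
  moreover have "infinite (range (\<lambda>n. prod_encode (i, prod_encode (i, n))))"
    using infinite_UNIV_nat by (auto simp: inj_def dest!: finite_imageD)
  ultimately have "\<not> range (\<lambda>n. prod_encode (i, prod_encode (i, n)))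
      \<subseteq> {x. g0 x \<noteq> x} \<union> {x. g1 x \<noteq> x}"
    using finite_subset by blast
  then obtain n where
    "prod_encode (i, prod_encode (i, n)) \<notin> {x. g0 x \<noteq> x} \<union> {x. g1 x \<noteq> x}"
    by blast
  moreover define x where "x = prod_encode (i, prod_encode (i, n))"
  ultimately have "base r j (f (prod_encode (0, x))) = x" "base r j (f (copy (psnd x))) = x"
    by (auto simp: g0_def g1_def)
  \<comment> \<open>The number \<open>x\<close> lies in column \<open>i\<close>, which is neither
    below \<open>j\<close> nor equal to \<open>j\<close>. Hence \<open>dup r j\<close> neither fixes
    \<open>x\<close> nor moves anything to it.\<close>
  moreover have "c = prod_encode (0, x)" if "base r j c = x" for c
    using that ij \<open>i \<noteq> j\<close>
    by (cases c rule: zero_or_copy_cases) (auto simp: dup_def x_def split: if_splits)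
  ultimately have "f (prod_encode (0, x)) = f (copy (psnd x))" by metis
  then show False using f(2) by (simp add: inj_eq)
qed

theorem corollary3p10:
  fixes r :: "nat rel"
  assumes "partial_order_on UNIV r"
    and "computable_set (prod_encode ` r)"
  shows "\<exists>(A :: nat set) (B :: nat \<Rightarrow> nat set).
           A \<le>\<^sub>T turing_jump {} \<and>
           (\<forall>i. B i \<equiv>\<^sub>b\<^sub>f\<^sub>o A) \<and>
           (\<forall>i j. B i \<le>\<^sub>1 B j \<longleftrightarrow> (i, j) \<in> r) \<and>
           order_embedding UNIV r
             (one_degrees_within (bfo_degree A)) (one_degree_order (bfo_degree A))
             (\<lambda>i. one_degree (B i))"
proof -
  obtain A where A: "A \<le>\<^sub>T turing_jump {}"
    and rigid: "\<And>g. computable g \<Longrightarrow> (\<And>x. x \<in> A \<longleftrightarrow> g x \<in> A) \<Longrightarrow> finite {x. g x \<noteq> x}"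
    using rigid_set_below_jump[of "{}"] by blast
  define B where "B = (\<lambda>i. base r i -` A)"
  have "refl r" using assms(1) by (simp add: partial_order_on_def preorder_on_def)
  have equiv: "B i \<equiv>\<^sub>b\<^sub>f\<^sub>o A" for i
    unfolding B_def by (rule base_vimage_bfo_equiv[OF assms(2)])
  have le_iff: "B i \<le>\<^sub>1 B j \<longleftrightarrow> (i, j) \<in> r" for i j
    unfolding B_def
    using base_vimage_one_le[OF assms] base_vimage_one_le_imp[OF rigid \<open>refl r\<close> assms(2)] by blast
  have within: "one_degree (B i) \<subseteq> bfo_degree A" for i
    by (rule one_degree_subset_bfo_degree[OF equiv])
  have "order_embedding UNIV r (one_degrees_within (bfo_degree A))
      (one_degree_order (bfo_degree A)) (\<lambda>i. one_degree (B i))"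
    unfolding order_embedding_def
    using within by (auto simp: one_degrees_within_def one_degree_order_iff le_iff)
  with A equiv le_iff show ?thesis by (intro exI[of _ A] exI[of _ B]) simp
qed

end
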